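(* If $MPF$ is a valley-marked parking function of size $n$ with $k$ marked valleys, then $$\operatorname{area}(MPF) + \operatorname{dinv}(MPF) + \binom{k+1}{2} \leq \binom{n}{2}.$$
   Context: A Dyck path of size $n$ goes from $(0,0)$ to $(n,n)$ with unit North/East steps weakly above $y=x$; a parking function of size $n$ is such a path with $n$ distinct positive integer cars placed one in the cell immediately right of each North step, increasing upward in each column. The cell with lower-left corner $(i,j)$ lies in the $(j-i)$-diagonal; left/right for cars refers to columns. $\operatorname{area}$ is the number of full cells between the path and $y=x$. A valley is an East step immediately followed by a North step such that the cell directly below the East step has no car or has a car smaller than the car next to that North step. A valley-marked parking function is a parking function with a subset of its valleys marked; the car next to a marked valley's North step is marked. For cars $s<b$: a primary diagonal inversion occurs if $s,b$ are in the same diagonal, $s$ is to the left of $b$, and $s$ is unmarked; a secondary diagonal inversion occurs if $b$ is in the diagonal one above $s$'s, $b$ is to the left of $s$, and $b$ is unmarked. $\operatorname{dinv}$ is the number of primary and secondary diagonal inversions minus the number of marked valleys. *)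

theory Defs
  imports Main
begin

text \<open>A path is a word of unit steps. A cell is named by its lower-left corner (i, j), so i is its
  column and j its row.\<close>

datatype step = North | East

type_synonym cell = "nat \<times> nat"

definition vertex :: "step list \<Rightarrow> nat \<Rightarrow> nat \<times> nat" where
  "vertex w p = (count_list (take p w) East, count_list (take p w) North)"

definition dyck_path :: "nat \<Rightarrow> step list \<Rightarrow> bool" where
  "dyck_path n w \<longleftrightarrow>
     vertex w (length w) = (n, n) \<and>
     (\<forall>p \<le> length w. fst (vertex w p) \<le> snd (vertex w p))"

text \<open>The North step starting at (i, j) has the cell (i, j) immediately to its right.\<close>

definition north_cells :: "step list \<Rightarrow> cell set" where
  "north_cells w = {vertex w p | p. p < length w \<and> w ! p = North}"

definition parking_function :: "nat \<Rightarrow> step list \<Rightarrow> (cell \<rightharpoonup> nat) \<Rightarrow> bool" where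
  "parking_function n w c \<longleftrightarrow>
     dyck_path n w \<and>
     dom c = north_cells w \<and>
     inj_on c (dom c) \<and>
     (\<forall>a \<in> ran c. 0 < a) \<and>
     (\<forall>i j j' a b. c (i, j) = Some a \<and> c (i, j') = Some b \<and> j < j' \<longrightarrow> a < b)"

text \<open>A cell (i, j) lies entirely above the line y = x iff its lower-right corner (i + 1, j) is weakly
  above that line, i.e. iff i < j; it is below the path iff the North step in row j has abscissa at
  most i.\<close>

definition area :: "step list \<Rightarrow> nat" where
  "area w = card {(i, j). i < j \<and> (\<exists>i' \<le> i. (i', j) \<in> north_cells w)}"

definition diagonal :: "cell \<Rightarrow> int" where
  "diagonal x = int (snd x) - int (fst x)"

text \<open>Valleys are identified by the position p of their East step in the word. That step runs from
  (i, j) to (i + 1, j), where j > 0 for a Dyck path, so the cell directly below it is (i, j - 1).\<close>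

definition is_valley :: "step list \<Rightarrow> (cell \<rightharpoonup> nat) \<Rightarrow> nat \<Rightarrow> bool" where
  "is_valley w c p \<longleftrightarrow>
     Suc p < length w \<and> w ! p = East \<and> w ! Suc p = North \<and>
     (let (i, j) = vertex w p in
        case c (i, j - 1) of
          None \<Rightarrow> True
        | Some a \<Rightarrow> a < the (c (vertex w (Suc p))))"

definition valley_marked_parking_function ::
    "nat \<Rightarrow> step list \<Rightarrow> (cell \<rightharpoonup> nat) \<Rightarrow> nat set \<Rightarrow> bool" where
  "valley_marked_parking_function n w c M \<longleftrightarrow>
     parking_function n w c \<and> M \<subseteq> {p. is_valley w c p}"

definition marked_cells :: "step list \<Rightarrow> nat set \<Rightarrow> cell set" where
  "marked_cells w M = (\<lambda>p. vertex w (Suc p)) ` M"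

definition primary_dinvs :: "step list \<Rightarrow> (cell \<rightharpoonup> nat) \<Rightarrow> nat set \<Rightarrow> (nat \<times> nat) set" where
  "primary_dinvs w c M =
     {(s, b). s < b \<and>
        (\<exists>x y. c x = Some s \<and> c y = Some b \<and>
           diagonal x = diagonal y \<and> fst x < fst y \<and> x \<notin> marked_cells w M)}"

definition secondary_dinvs :: "step list \<Rightarrow> (cell \<rightharpoonup> nat) \<Rightarrow> nat set \<Rightarrow> (nat \<times> nat) set" where
  "secondary_dinvs w c M =
     {(s, b). s < b \<and>
        (\<exists>x y. c x = Some s \<and> c y = Some b \<and>
           diagonal y = diagonal x + 1 \<and> fst y < fst x \<and> y \<notin> marked_cells w M)}"

definition dinv :: "step list \<Rightarrow> (cell \<rightharpoonup> nat) \<Rightarrow> nat set \<Rightarrow> int" where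
  "dinv w c M =
     int (card (primary_dinvs w c M)) + int (card (secondary_dinvs w c M)) - int (card M)"

end

theory Submission imports Defs begin

text \<open>
  Since \<open>(k + 1 choose 2) - k = (k choose 2)\<close>, it suffices to inject the area cells, the
  diagonal inversions and the pairs of marked cars disjointly into the pairs \<open>(x, y)\<close> of car cells
  with \<open>x\<close> in a lower row than \<open>y\<close>. A diagonal inversion is sent to its two cells; the lower one is
  unmarked. An area cell in the row of the car cell \<open>y\<close> corresponds to some \<open>d\<close> smaller than the
  diagonal of \<open>y\<close>, and is sent to \<open>(x, y)\<close> where \<open>x\<close> belongs to the North step by which the path
  first leaves diagonal \<open>d\<close> upwards. That step is not preceded by an East step, so \<open>x\<close> is unmarked.
  Comparing the diagonals of \<open>x\<close> and \<open>y\<close> shows that the images are disjoint.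
\<close>

text \<open>As \<open>f\<close> is injective on \<open>A\<close>, every two-element subset of
  \<open>A\<close> can be listed in exactly one way with increasing values of
  \<open>f\<close>.\<close>

lemma card_less_pairs:
  fixes f :: "'a \<Rightarrow> 'b::linorder"
  assumes "finite A" "inj_on f A"
  shows "card {(x, y). x \<in> A \<and> y \<in> A \<and> f x < f y} = card A choose 2"
proof -
  have "bij_betw (\<lambda>(x, y). {x, y}) {(x, y). x \<in> A \<and> y \<in> A \<and> f x < f y}
      {B. B \<subseteq> A \<and> card B = 2}"
    unfolding bij_betw_def
  proof
    show "inj_on (\<lambda>(x, y). {x, y}) {(x, y). x \<in> A \<and> y \<in> A \<and> f x < f y}"
      by (auto simp: inj_on_def doubleton_eq_iff)
    show "(\<lambda>(x, y). {x, y}) ` {(x, y). x \<in> A \<and> y \<in> A \<and> f x < f y} = {B. B \<subseteq> A \<and> card B = 2}"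
    proof (intro equalityI subsetI)
      fix B assume "B \<in> {B. B \<subseteq> A \<and> card B = 2}"
      then obtain x y where B: "B = {x, y}" "x \<noteq> y" "x \<in> A" "y \<in> A"
        by (auto simp: card_2_iff)
      then have "f x < f y \<or> f y < f x"
        using assms(2) by (metis inj_onD neqE)
      then show "B \<in> (\<lambda>(x, y). {x, y}) ` {(x, y). x \<in> A \<and> y \<in> A \<and> f x < f y}"
        using B by (auto simp: image_iff doubleton_eq_iff)
    qed (auto simp: card_2_iff)
  qed
  then show ?thesis
    by (simp add: bij_betw_same_card n_subsets[OF assms(1)])
qed

lemma vertex_0 [simp]: "vertex w 0 = (0, 0)"
  by (simp add: vertex_def)

lemma vertex_Suc:
  assumes "p < length w"
  shows "vertex w (Suc p) = (case w ! p of
    North \<Rightarrow> (fst (vertex w p), Suc (snd (vertex w p)))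
  | East \<Rightarrow> (Suc (fst (vertex w p)), snd (vertex w p)))"
  using assms by (cases "w ! p") (auto simp: vertex_def take_Suc_conv_app_nth)

lemma vertex_mono:
  assumes "p \<le> q" "q \<le> length w"
  shows "fst (vertex w p) \<le> fst (vertex w q)" "snd (vertex w p) \<le> snd (vertex w q)"
proof -
  have "take q w = take p w @ take (q - p) (drop p w)"
    using assms(1) by (metis le_add_diff_inverse take_add)
  then show "fst (vertex w p) \<le> fst (vertex w q)" "snd (vertex w p) \<le> snd (vertex w q)"
    by (simp_all add: vertex_def)
qed

lemma snd_vertex_less:
  assumes "p < q" "q \<le> length w" "w ! p = North"
  shows "snd (vertex w p) < snd (vertex w q)"
  using assms vertex_mono(2)[of "Suc p" q w] vertex_Suc[of p w] by auto

text \<open>Each step raises one of the two coordinates and none ever decreases, so the path never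
  returns to a vertex.\<close>

lemma vertex_inj:
  assumes "p \<le> length w" "q \<le> length w" "vertex w p = vertex w q"
  shows "p = q"
proof -
  have ne: "vertex w r \<noteq> vertex w s" if "r < s" "s \<le> length w" for r s
    using that vertex_mono[of "Suc r" s w] vertex_Suc[of r w] by (auto split: step.splits)
  show ?thesis
    using assms ne by (metis linorder_neqE_nat)
qed

text \<open>A North step leaves its row for good. Hence rows order the car cells strictly, which
  makes \<open>snd\<close> a suitable key for \<open>card_less_pairs\<close>.\<close>

lemma inj_on_row_north_cells: "inj_on snd (north_cells w)"
proof (rule inj_onI)
  fix x y assume "x \<in> north_cells w" "y \<in> north_cells w" "snd x = snd y"
  then obtain p q where "x = vertex w p" "p < length w" "w ! p = North"
    "y = vertex w q" "q < length w" "w ! q = North"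
    by (auto simp: north_cells_def)
  with \<open>snd x = snd y\<close> show "x = y"
    using snd_vertex_less[of p q w] snd_vertex_less[of q p w] by (cases p q rule: linorder_cases) auto
qed

lemma finite_north_cells: "finite (north_cells w)"
proof -
  have "north_cells w \<subseteq> vertex w ` {..<length w}"
    by (auto simp: north_cells_def)
  then show ?thesis
    using finite_surj by blast
qed

lemma card_north_cells_le:
  assumes "dyck_path n w"
  shows "card (north_cells w) \<le> n"
proof -
  have "snd ` north_cells w \<subseteq> {..<n}"
    using assms snd_vertex_less[of _ "length w" w] by (auto simp: north_cells_def dyck_path_def)
  then have "card (snd ` north_cells w) \<le> n"
    by (metis card_lessThan card_mono finite_lessThan)
  then show ?thesis
    by (simp add: card_image inj_on_row_north_cells)
qed

lemma marked_cells_subset: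
  assumes "M \<subseteq> {p. is_valley w c p}"
  shows "marked_cells w M \<subseteq> north_cells w"
  using assms by (auto simp: marked_cells_def north_cells_def is_valley_def)

lemma card_marked_cells:
  assumes "M \<subseteq> {p. is_valley w c p}"
  shows "card (marked_cells w M) = card M"
proof -
  have "inj_on (\<lambda>p. vertex w (Suc p)) M"
  proof (rule inj_onI)
    fix p q assume "p \<in> M" "q \<in> M" "vertex w (Suc p) = vertex w (Suc q)"
    moreover from this have "Suc p < length w" "Suc q < length w"
      using assms by (auto simp: is_valley_def)
    ultimately show "p = q"
      using vertex_inj[of "Suc p" w "Suc q"] by simp
  qed
  then show ?thesis
    by (simp add: marked_cells_def card_image)
qed

text \<open>This supplies the lower cell for an area cell. The path starts on diagonal 0 and
  \<open>y\<close> lies above diagonal \<open>d\<close>, so some first step climbs from diagonal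
  \<open>d\<close> to \<open>d + 1\<close>, and it comes before the North step at
  \<open>y\<close>.\<close>

lemma ex_unmarked_cell_below:
  assumes valleys: "M \<subseteq> {p. is_valley w c p}"
    and y: "y \<in> north_cells w" and d: "fst y + d < snd y"
  shows "\<exists>x \<in> north_cells w. x \<notin> marked_cells w M \<and> snd x = fst x + d \<and> snd x < snd y"
proof -
  obtain p where p: "y = vertex w p" "p < length w" "w ! p = North"
    using y by (auto simp: north_cells_def)
  define P where "P q \<longleftrightarrow> fst (vertex w q) + d < snd (vertex w q)" for q
  define q where "q = (LEAST q. P q)"
  have "P p"
    using d p by (simp add: P_def)
  then have "P q" "q \<le> p"
    unfolding q_def by (auto intro: LeastI Least_le)
  have below_q: "\<not> P r" if "r < q" for r
    using that not_less_Least q_def by blast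
  \<comment> \<open>The origin is not above diagonal \<open>d\<close>, so the first vertex that is
    has a step leading to it.\<close>
  from \<open>P q\<close> obtain r where r: "q = Suc r"
    by (cases q) (auto simp: P_def)
  then have "r < length w"
    using \<open>q \<le> p\<close> p by simp
  \<comment> \<open>An East step would lower the diagonal; a North step raises it by one, so it must
    start exactly on diagonal \<open>d\<close>.\<close>
  have "w ! r = North" and diag: "snd (vertex w r) = fst (vertex w r) + d"
    using \<open>P q\<close> below_q[of r] vertex_Suc[OF \<open>r < length w\<close>]
    by (auto simp: P_def r split: step.splits)
  have "vertex w r \<notin> marked_cells w M"
  proof
    assume "vertex w r \<in> marked_cells w M"
    then obtain s where s: "s \<in> M" "vertex w r = vertex w (Suc s)"
      by (auto simp: marked_cells_def)
    then have "Suc s < length w" "w ! s = East"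
      using valleys by (auto simp: is_valley_def)
    moreover from this have "r = Suc s"
      using s \<open>r < length w\<close> vertex_inj[of r w "Suc s"] by simp
    \<comment> \<open>An East step ending on diagonal \<open>d\<close> starts on diagonal
      \<open>d + 1\<close>, too early for the minimality of \<open>q\<close>.\<close>
    ultimately have "P s"
      using diag vertex_Suc[of s w] by (simp add: P_def)
    then show False
      using below_q[of s] r \<open>r = Suc s\<close> by simp
  qed
  moreover have "snd (vertex w r) < snd y"
    using snd_vertex_less[of r p w] \<open>w ! r = North\<close> p r \<open>q \<le> p\<close> by simp
  ultimately show ?thesis
    using diag \<open>w ! r = North\<close> \<open>r < length w\<close>
    by (intro bexI[of _ "vertex w r"]) (auto simp: north_cells_def)
qed

text \<open>Inversions are pairs of cars. Reading off the cars maps the pairs of cells related by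
  \<open>R\<close> onto a set containing \<open>I\<close>.\<close>

lemma card_inversions_le:
  assumes "dom c = N" "finite N"
    and "\<And>s b. (s, b) \<in> I \<Longrightarrow> \<exists>x y. c x = Some s \<and> c y = Some b \<and> R x y"
  shows "card I \<le> card {(x, y). x \<in> N \<and> y \<in> N \<and> R x y}"
proof -
  have "I \<subseteq> (\<lambda>(x, y). (the (c x), the (c y))) ` {(x, y). x \<in> N \<and> y \<in> N \<and> R x y}"
  proof clarify
    fix s b assume "(s, b) \<in> I"
    then obtain x y where "c x = Some s" "c y = Some b" "R x y"
      using assms(3) by blast
    then show "(s, b) \<in> (\<lambda>(x, y). (the (c x), the (c y))) ` {(x, y). x \<in> N \<and> y \<in> N \<and> R x y}"
      using assms(1) by (intro image_eqI[of _ _ "(x, y)"]) auto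
  qed
  moreover have "finite {(x, y). x \<in> N \<and> y \<in> N \<and> R x y}"
    by (rule finite_subset[of _ "N \<times> N"]) (use assms(2) in auto)
  ultimately show ?thesis
    by (rule surj_card_le[rotated])
qed

theorem theorem4p7:
  fixes n k :: nat and w :: "step list" and c :: "cell \<rightharpoonup> nat" and M :: "nat set"
  assumes "valley_marked_parking_function n w c M"
    and "card M = k"
  shows "int (area w) + dinv w c M + int ((k + 1) choose 2) \<le> int (n choose 2)"
proof -
  define N where "N = north_cells w"
  define K where "K = marked_cells w M"
  have valleys: "M \<subseteq> {p. is_valley w c p}" and dyck: "dyck_path n w"
    and dom: "dom c = N"
    using assms(1) by (auto simp: valley_marked_parking_function_def parking_function_def N_def)
  have finN: "finite N" and injN: "inj_on snd N" and KN: "K \<subseteq> N" and cardK: "card K = k"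
    using finite_north_cells inj_on_row_north_cells marked_cells_subset[OF valleys]
      card_marked_cells[OF valleys] assms(2) by (auto simp: N_def K_def)
  \<comment> \<open>The common target: pairs of car cells with the lower row first, restricted by
    \<open>R\<close>.\<close>
  define pairs where "pairs R = {(x, y). x \<in> N \<and> y \<in> N \<and> snd x < snd y \<and> R x y}"
    for R :: "cell \<Rightarrow> cell \<Rightarrow> bool"
  have fin: "finite (pairs R)" for R
    by (rule finite_subset[of _ "N \<times> N"]) (use finN in \<open>auto simp: pairs_def\<close>)
  define A where "A = pairs (\<lambda>x y. x \<notin> K \<and> diagonal x < diagonal y)"
  define D1 where "D1 = pairs (\<lambda>x y. x \<notin> K \<and> diagonal x = diagonal y)"
  define D2 where "D2 = pairs (\<lambda>x y. x \<notin> K \<and> diagonal x = diagonal y + 1)"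
  define KK where "KK = pairs (\<lambda>x y. x \<in> K \<and> y \<in> K)"

  have primary: "card (primary_dinvs w c M) \<le> card D1"
    unfolding D1_def pairs_def
  proof (rule card_inversions_le[OF dom finN])
    fix s b assume "(s, b) \<in> primary_dinvs w c M"
    then obtain x y where "c x = Some s" "c y = Some b" "diagonal x = diagonal y"
      "fst x < fst y" "x \<notin> K"
      by (auto simp: primary_dinvs_def K_def)
    moreover from this have "snd x < snd y"
      by (simp add: diagonal_def)
    ultimately show "\<exists>x y. c x = Some s \<and> c y = Some b \<and> snd x < snd y \<and> x \<notin> K \<and>
        diagonal x = diagonal y"
      by blast
  qed

  \<comment> \<open>In a secondary inversion the larger car is in the lower row, so the pair is
    swapped to put it first.\<close>
  have "card (secondary_dinvs w c M) = card (prod.swap ` secondary_dinvs w c M)"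
    by (simp add: card_image)
  also have "\<dots> \<le> card D2"
    unfolding D2_def pairs_def
  proof (rule card_inversions_le[OF dom finN])
    fix b s assume "(b, s) \<in> prod.swap ` secondary_dinvs w c M"
    then obtain x y where "c x = Some s" "c y = Some b" "diagonal y = diagonal x + 1"
      "fst y < fst x" "y \<notin> K"
      by (auto simp: secondary_dinvs_def K_def)
    moreover from this have "snd y < snd x"
    proof -
      \<comment> \<open>The diagonals and columns give only \<open>snd y \<le> snd x\<close>;
        equality is excluded because no two car cells share a row.\<close>
      have "snd y \<noteq> snd x"
        using calculation dom injN by (metis domI inj_onD less_irrefl)
      then show ?thesis
        using calculation by (simp add: diagonal_def)
    qed
    ultimately show "\<exists>x y. c x = Some b \<and> c y = Some s \<and> snd x < snd y \<and> x \<notin> K \<and>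
        diagonal x = diagonal y + 1"
      by blast
  qed
  finally have secondary: "card (secondary_dinvs w c M) \<le> card D2" .

  have "area w \<le> card A"
  proof -
    \<comment> \<open>The area cell \<open>(i, j)\<close> lies on diagonal \<open>d + 1\<close> for
      \<open>d = j - 1 - i\<close>, so \<open>i\<close> is recovered from the diagonal
      \<open>d\<close> of \<open>x\<close> and the row \<open>j\<close> of \<open>y\<close>.\<close>
    let ?g = "\<lambda>(x, y). (snd y - 1 - nat (diagonal x), snd y)"
    have "{(i, j). i < j \<and> (\<exists>i' \<le> i. (i', j) \<in> N)} \<subseteq> ?g ` A"
    proof clarify
      fix i j i' :: nat assume ij: "i < j" "i' \<le> i" "(i', j) \<in> N"
      then have "\<exists>x \<in> N. x \<notin> K \<and> snd x = fst x + (j - 1 - i) \<and> snd x < snd (i', j)"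
        unfolding N_def K_def by (intro ex_unmarked_cell_below[OF valleys]) auto
      then obtain x where x: "x \<in> N" "x \<notin> K" "snd x = fst x + (j - 1 - i)" "snd x < j"
        by force
      have "(x, (i', j)) \<in> A"
        using x ij by (auto simp: A_def pairs_def diagonal_def)
      moreover have "(i, j) = ?g (x, (i', j))"
        using x ij by (auto simp: diagonal_def)
      ultimately show "(i, j) \<in> ?g ` A"
        by (rule rev_image_eqI)
    qed
    then show ?thesis
      unfolding area_def N_def[symmetric] by (rule surj_card_le[rotated]) (simp add: A_def fin)
  qed

  moreover have "card KK = k choose 2"
  proof -
    have "KK = {(x, y). x \<in> K \<and> y \<in> K \<and> snd x < snd y}"
      using KN by (auto simp: KK_def pairs_def)
    then show ?thesis
      using card_less_pairs[of K snd] KN finN injN cardK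
      by (simp add: finite_subset inj_on_subset)
  qed

  moreover have "card A + card D1 + card D2 + card KK \<le> n choose 2"
  proof -
    have "finite A" "finite D1" "finite D2" "finite KK"
      using fin by (simp_all add: A_def D1_def D2_def KK_def)
    \<comment> \<open>In \<open>A\<close>, \<open>D1\<close> and \<open>D2\<close> the diagonal of
      \<open>x\<close> is below, equal to, and one above that of \<open>y\<close>; only in
      \<open>KK\<close> is \<open>x\<close> marked.\<close>
    moreover have "A \<inter> D1 = {}" "(A \<union> D1) \<inter> D2 = {}" "(A \<union> D1 \<union> D2) \<inter> KK = {}"
      by (auto simp: A_def D1_def D2_def KK_def pairs_def)
    ultimately have "card A + card D1 + card D2 + card KK = card (A \<union> D1 \<union> D2 \<union> KK)"
      by (simp add: card_Un_disjoint)
    also have "\<dots> \<le> card (pairs (\<lambda>_ _. True))"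
      by (rule card_mono[OF fin]) (auto simp: A_def D1_def D2_def KK_def pairs_def)
    also have "\<dots> = card N choose 2"
      using card_less_pairs[OF finN injN] by (simp add: pairs_def)
    also have "\<dots> \<le> n choose 2"
      using card_north_cells_le[OF dyck] by (simp add: N_def binomial_right_mono)
    finally show ?thesis .
  qed

  moreover have "(k + 1) choose 2 = (k choose 2) + k"
    by (simp add: numeral_2_eq_2)
  ultimately show ?thesis
    using primary secondary assms(2) by (simp add: dinv_def)
qed

end
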